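(* Let $f\in\mathcal{C}_{e}$ with $f(z)=z+a_2z^2+a_3z^3+\cdots$. Then $$|H_3(1)|\le \frac{1}{144},$$ where $H_3(1)=2a_2a_3a_4-a_3^3-a_4^2-a_2^2a_5+a_3a_5$. This bound is sharp, i.e. there is a function in $\mathcal{C}_{e}$ for which equality holds.
   Context: Let $\mathbb{D}=\{z\in\mathbb{C}:|z|<1\}$ and let $\mathcal{A}$ be the set of analytic functions $f$ on $\mathbb{D}$ of the form $f(z)=z+a_2z^2+a_3z^3+\cdots$. For functions $h_1,h_2$ analytic on $\mathbb{D}$, $h_1\prec h_2$ ($h_1$ is subordinate to $h_2$) means that there is a Schwarz function $w$, i.e. an analytic $w$ on $\mathbb{D}$ with $w(0)=0$ and $|w(z)|\le|z|$, such that $h_1(z)=h_2(w(z))$ on $\mathbb{D}$. The class $\mathcal{C}_{e}$ is $$\mathcal{C}_{e}=\left\{f\in\mathcal{A}:1+\frac{zf''(z)}{f'(z)}\prec e^{z}\right\}.$$ For $f\in\mathcal{A}$ with $a_1=1$, the Hankel determinant $H_q(n)$ is the determinant of the $q\times q$ matrix whose $(i,j)$ entry is $a_{n+i+j-2}$, $1\le i,j\le q$; for $q=3$, $n=1$ it equals the expression given for $H_3(1)$. *)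

theory Defs
  imports "HOL-Complex_Analysis.Complex_Analysis" "Jordan_Normal_Form.Determinant"
begin

definition class_A :: "(complex \<Rightarrow> complex) set" where
  "class_A = {f. f holomorphic_on ball 0 1 \<and> f 0 = 0 \<and> deriv f 0 = 1}"

definition schwarz_function :: "(complex \<Rightarrow> complex) \<Rightarrow> bool" where
  "schwarz_function w \<longleftrightarrow>
     w holomorphic_on ball 0 1 \<and> w 0 = 0 \<and> (\<forall>z\<in>ball 0 1. norm (w z) \<le> norm z)"

definition subordinate :: "(complex \<Rightarrow> complex) \<Rightarrow> (complex \<Rightarrow> complex) \<Rightarrow> bool"
    (infix "\<prec>\<^sub>s" 50) where
  "h1 \<prec>\<^sub>s h2 \<longleftrightarrow>
     h1 holomorphic_on ball 0 1 \<and> h2 holomorphic_on ball 0 1 \<and>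
     (\<exists>w. schwarz_function w \<and> (\<forall>z\<in>ball 0 1. h1 z = h2 (w z)))"

(* No separate condition that f' has no zeros is needed: at a zero of f' (which is not 0, as
   f'(0) = 1) the quotient has a pole, so however division by zero is evaluated there, the left
   hand side is not holomorphic on the disc and the subordination fails. *)
definition class_C_e :: "(complex \<Rightarrow> complex) set" where
  "class_C_e = {f \<in> class_A. (\<lambda>z. 1 + z * deriv (deriv f) z / deriv f z) \<prec>\<^sub>s exp}"

definition taylor_coeff :: "(complex \<Rightarrow> complex) \<Rightarrow> nat \<Rightarrow> complex" where
  "taylor_coeff f n = fps_nth (fps_expansion f 0) n"

(* Matrix indices start at 0 here, so the entry a_(n+i+j-2) for 1 <= i,j <= q becomes a_(n+i+j). *)
definition hankel_det :: "(nat \<Rightarrow> complex) \<Rightarrow> nat \<Rightarrow> nat \<Rightarrow> complex" where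
  "hankel_det a q n = Determinant.det (Matrix.mat q q (\<lambda>(i, j). a (n + i + j)))"

end

theory Submission
  imports Defs
begin

text \<open>
  Write \<open>1 + z f''/f' = exp w\<close> with a Schwarz function \<open>w(z) = c\<^sub>1 z + c\<^sub>2 z\<^sup>2 + \<dots>\<close>.
  Comparing coefficients in \<open>z f'' = f' (exp w - 1)\<close> expresses \<open>a\<^sub>2, \<dots>, a\<^sub>5\<close> through
  \<open>c\<^sub>1, \<dots>, c\<^sub>4\<close>, and the Hankel determinant turns into a polynomial with
  \<open>144 H\<^sub>3(1) = 6/5 c\<^sub>2 c\<^sub>4 - c\<^sub>3\<^sup>2 + \<dots>\<close> (\<open>hankel_det_convex_exp\<close>). The term \<open>c\<^sub>3\<^sup>2\<close> is
  the decisive one: \<open>w(z) = z\<^sup>3\<close> annihilates all the others and gives \<open>144 H\<^sub>3(1) = -1\<close>.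

  That this is extremal does not follow from bounds on the individual coefficients, because
  \<open>c\<^sub>4\<close> has to be small when \<open>c\<^sub>3\<close> is large. Schur's algorithm encodes this dependence exactly:
  it parametrizes \<open>c\<^sub>1, \<dots>, c\<^sub>4\<close> by four independent points \<open>c, x, y, \<zeta>\<close> of the closed unit
  disc (\<open>schwarz_function_coeffs\<close>). In these parameters the plain triangle inequality is good
  enough: it bounds \<open>144 |H\<^sub>3(1)|\<close> by a real polynomial in \<open>|c|, |x|, |y|\<close>
  (\<open>norm_schwarz_hankel_le\<close>), which is at most \<open>1\<close> on the unit cube
  (\<open>schur_parameter_inequality\<close>). The function belonging to \<open>w(z) = z\<^sup>3\<close> is
  obtained by integrating the differential equation twice (\<open>convex_exp_function_exists\<close>).
\<close>

section \<open>Schur parameters\<close>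

text \<open>Non-strict boundedness keeps the unimodular constants in the class, so that Schur's
  algorithm below never has to stop.\<close>
definition schur_class :: "(complex \<Rightarrow> complex) set" where
  "schur_class = {g. g holomorphic_on ball 0 1 \<and> (\<forall>z\<in>ball 0 1. norm (g z) \<le> 1)}"

lemma schwarz_function_quotient:
  assumes "schwarz_function w"
  obtains g where "g \<in> schur_class" "\<And>z. norm z < 1 \<Longrightarrow> w z = z * g z"
proof -
  have hol: "w holomorphic_on ball 0 1" and w0: "w 0 = 0"
    and le: "\<And>z. norm z < 1 \<Longrightarrow> norm (w z) \<le> norm z"
    using assms by (auto simp: schwarz_function_def)
  obtain g where g: "g holomorphic_on ball 0 1" "\<And>z. norm z < 1 \<Longrightarrow> w z = z * g z"
    "deriv w 0 = g 0"
    using Schwarz3[OF hol w0] by blast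
  have "norm (g z) \<le> 1" if z: "norm z < 1" for z
  proof (cases "z = 0")
    case True
    have "norm (w \<xi>) < 1" if "norm \<xi> < 1" for \<xi>
      using le[OF that] that by simp
    then have "norm (deriv w 0) \<le> 1"
      using Schwarz_Lemma(2)[OF hol w0, of 0] by simp
    then show ?thesis using True g(3) by simp
  next
    case False
    then show ?thesis
      using le[OF z] g(2)[OF z] by (simp add: norm_mult)
  qed
  then show ?thesis
    using that[of g] g(1,2) by (auto simp: schur_class_def)
qed

text \<open>One step of Schur's algorithm: \<open>z h(z)\<close> is the image of \<open>g\<close> under the disc automorphism
  that moves \<open>g 0\<close> to \<open>0\<close>, and \<open>h\<close> inherits the bound by the Schwarz lemma. The relation is
  stated without a quotient: in this form it also covers the case \<open>|g 0| = 1\<close>, in which \<open>g\<close>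
  is constant by the maximum principle and \<open>h = 0\<close> will do.\<close>
lemma schur_step:
  assumes "g \<in> schur_class"
  obtains h where "h \<in> schur_class"
    "\<And>z. norm z < 1 \<Longrightarrow> g z * (1 + cnj (g 0) * (z * h z)) = g 0 + z * h z"
proof -
  have hol: "g holomorphic_on ball 0 1" and le: "\<And>z. norm z < 1 \<Longrightarrow> norm (g z) \<le> 1"
    using assms by (auto simp: schur_class_def)
  show ?thesis
  proof (cases "\<exists>z. norm z < 1 \<and> norm (g z) = 1")
    case True
    then obtain \<xi> where \<xi>: "norm \<xi> < 1" "norm (g \<xi>) = 1" by blast
    have "g constant_on ball 0 1"
      by (rule maximum_modulus_principle[OF hol, where U = "ball 0 1" and \<xi> = \<xi>])
         (use \<xi> le in auto)
    then have const: "g z = g 0" if "norm z < 1" for z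
      using that unfolding constant_on_def by fastforce
    show ?thesis
    proof (rule that[of "\<lambda>_. 0"])
      show "g z * (1 + cnj (g 0) * (z * 0)) = g 0 + z * 0" if "norm z < 1" for z
        using const[OF that] by simp
    qed (simp add: schur_class_def)
  next
    case False
    then have lt: "norm (g z) < 1" if "norm z < 1" for z
      using le[OF that] that by fastforce
    define m where "m = (\<lambda>z. Moebius_function 0 (g 0) (g z))"
    have g0: "norm (g 0) < 1" using lt[of 0] by simp
    have m0: "m 0 = 0" by (simp add: m_def Moebius_function_eq_zero)
    have m_lt: "norm (m z) < 1" if "norm z < 1" for z
      unfolding m_def by (rule Moebius_function_norm_lt_1[OF g0 lt[OF that]])
    have m_hol: "m holomorphic_on ball 0 1"
    proof -
      have "Moebius_function 0 (g 0) \<circ> g holomorphic_on ball 0 1"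
        by (rule holomorphic_on_compose_gen[OF hol Moebius_function_holomorphic[OF g0]])
           (use lt in auto)
      then show ?thesis by (simp add: m_def o_def)
    qed
    have "schwarz_function m"
      unfolding schwarz_function_def
      using m_hol m0 Schwarz_Lemma(1)[OF m_hol m0 m_lt] by auto
    then obtain h where h: "h \<in> schur_class" "\<And>z. norm z < 1 \<Longrightarrow> m z = z * h z"
      by (rule schwarz_function_quotient) blast
    have "g z * (1 + cnj (g 0) * (z * h z)) = g 0 + z * h z" if z: "norm z < 1" for z
    proof -
      have "norm (cnj (g 0) * g z) < 1"
        using norm_mult_less[of "cnj (g 0)" 1 "g z" 1] g0 lt[OF z] by simp
      then have "1 - cnj (g 0) * g z \<noteq> 0" by auto
      then have "m z * (1 - cnj (g 0) * g z) = g z - g 0"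
        by (simp add: m_def Moebius_function_simple)
      then show ?thesis
        unfolding h(2)[OF z] by (simp add: algebra_simps)
    qed
    then show ?thesis using that h(1) by blast
  qed
qed

lemma holomorphic_on_unit_disc_has_fps_expansion:
  "f holomorphic_on ball 0 1 \<Longrightarrow> f has_fps_expansion fps_expansion f 0"
  by (rule has_fps_expansion_fps_expansion[of "ball 0 1"]) auto

lemma eventually_in_unit_disc: "\<forall>\<^sub>F z in nhds 0. norm (z :: complex) < 1"
  using eventually_nhds_in_open[of "ball 0 1" "0 :: complex"] by simp

text \<open>Since \<open>z h(z)\<close> has no constant term, comparing coefficients in the relation of
  \<open>schur_step\<close> gives each coefficient of \<open>g\<close> from those of \<open>h\<close> of smaller index.\<close>
lemma schur_step_coeffs:
  assumes "g \<in> schur_class"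
  defines "G \<equiv> fps_expansion g 0"
  defines "c \<equiv> fps_nth G 0"
  defines "s \<equiv> 1 - c * cnj c"
  obtains h H where "h \<in> schur_class" "H = fps_expansion h 0"
    "fps_nth G 1 = s * fps_nth H 0"
    "fps_nth G 2 = s * (fps_nth H 1 - cnj c * (fps_nth H 0)\<^sup>2)"
    "fps_nth G 3 = s * (fps_nth H 2 - 2 * cnj c * fps_nth H 0 * fps_nth H 1
                        + (cnj c)\<^sup>2 * fps_nth H 0 ^ 3)"
proof -
  obtain h where h: "h \<in> schur_class"
    "\<And>z. norm z < 1 \<Longrightarrow> g z * (1 + cnj (g 0) * (z * h z)) = g 0 + z * h z"
    using schur_step[OF assms(1)] by blast
  define H where "H = fps_expansion h 0"
  have gG: "g has_fps_expansion G" and hH: "h has_fps_expansion H"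
    unfolding G_def H_def using assms(1) h(1)
    by (auto simp: schur_class_def intro: holomorphic_on_unit_disc_has_fps_expansion)
  have c: "g 0 = c"
    using has_fps_expansion_imp_0_eq_fps_nth_0[OF gG] by (simp add: c_def)
  have "(\<lambda>z. g z * (1 + cnj c * (z * h z))) has_fps_expansion
          G * (1 + fps_const (cnj c) * (fps_X * H))"
    by (intro fps_expansion_intros gG hH)
  moreover have "(\<lambda>z. g z * (1 + cnj c * (z * h z))) has_fps_expansion fps_const c + fps_X * H"
  proof (subst has_fps_expansion_cong[OF _ refl])
    show "\<forall>\<^sub>F z in nhds 0. g z * (1 + cnj c * (z * h z)) = c + z * h z"
      using eventually_in_unit_disc by eventually_elim (use h(2) c in auto)
    show "(\<lambda>z. c + z * h z) has_fps_expansion fps_const c + fps_X * H"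
      by (intro fps_expansion_intros hH)
  qed
  ultimately have eq: "G * (1 + fps_const (cnj c) * (fps_X * H)) = fps_const c + fps_X * H"
    by (rule fps_expansion_unique_complex)
  have nth: "fps_nth (G * (1 + fps_const (cnj c) * (fps_X * H))) n
      = fps_nth (fps_const c + fps_X * H) n" for n
    by (simp add: eq)
  note expand = fps_mult_nth eval_nat_numeral c_def[symmetric]
  have rec1: "fps_nth G 1 = fps_nth H 0 - cnj c * (c * fps_nth H 0)"
    using nth[of 1] by (simp add: expand algebra_simps)
  have rec2: "fps_nth G 2 = fps_nth H 1 - cnj c * (c * fps_nth H 1 + fps_nth G 1 * fps_nth H 0)"
    using nth[of 2] by (simp add: expand algebra_simps)
  have rec3: "fps_nth G 3 = fps_nth H 2
      - cnj c * (c * fps_nth H 2 + fps_nth G 1 * fps_nth H 1 + fps_nth G 2 * fps_nth H 0)"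
    using nth[of 3] by (simp add: expand algebra_simps)
  have 1: "fps_nth G 1 = s * fps_nth H 0"
    unfolding rec1 s_def by (simp add: algebra_simps)
  have 2: "fps_nth G 2 = s * (fps_nth H 1 - cnj c * (fps_nth H 0)\<^sup>2)"
    unfolding rec2 1 s_def by (simp add: algebra_simps power2_eq_square)
  have 3: "fps_nth G 3 = s * (fps_nth H 2 - 2 * cnj c * fps_nth H 0 * fps_nth H 1
                        + (cnj c)\<^sup>2 * fps_nth H 0 ^ 3)"
    unfolding rec3 1 2 s_def by (simp add: algebra_simps power2_eq_square power3_eq_cube)
  show ?thesis using that[OF h(1) H_def 1 2 3] .
qed

text \<open>The Schur parameters \<open>c, x, y, \<zeta>\<close> are the values at \<open>0\<close> of \<open>w(z)/z\<close> and of the functions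
  produced from it by three steps of Schur's algorithm. The factors \<open>s, r, t\<close> have names of
  their own so that the later algebra can treat them as atoms.\<close>
lemma schwarz_function_coeffs:
  assumes "schwarz_function w"
  defines "W \<equiv> fps_expansion w 0"
  obtains c x y \<zeta> s r t where
    "norm c \<le> 1" "norm x \<le> 1" "norm y \<le> 1" "norm \<zeta> \<le> 1"
    "s = 1 - c * cnj c" "r = 1 - x * cnj x" "t = 1 - y * cnj y"
    "fps_nth W 1 = c"
    "fps_nth W 2 = s * x"
    "fps_nth W 3 = s * (r * y - cnj c * x\<^sup>2)"
    "fps_nth W 4 = s * (r * (t * \<zeta> - cnj x * y\<^sup>2) - 2 * cnj c * x * (r * y) + (cnj c)\<^sup>2 * x ^ 3)"
proof -
  obtain g where g: "g \<in> schur_class" "\<And>z. norm z < 1 \<Longrightarrow> w z = z * g z"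
    using schwarz_function_quotient[OF assms(1)] by blast
  define G where "G = fps_expansion g 0"
  have le: "norm (fps_nth (fps_expansion k 0) 0) \<le> 1" if "k \<in> schur_class" for k
    using that has_fps_expansion_imp_0_eq_fps_nth_0[OF
        holomorphic_on_unit_disc_has_fps_expansion, of k, symmetric]
    by (auto simp: schur_class_def)
  have gG: "g has_fps_expansion G"
    unfolding G_def using g(1)
    by (auto simp: schur_class_def intro: holomorphic_on_unit_disc_has_fps_expansion)
  have "w has_fps_expansion fps_X * G"
  proof (subst has_fps_expansion_cong[OF _ refl])
    show "\<forall>\<^sub>F z in nhds 0. w z = z * g z"
      using eventually_in_unit_disc by eventually_elim (use g(2) in auto)
    show "(\<lambda>z. z * g z) has_fps_expansion fps_X * G"
      by (intro fps_expansion_intros gG)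
  qed
  then have W: "W = fps_X * G"
    unfolding W_def by (rule fps_expansion_eqI)
  obtain h H where h: "h \<in> schur_class" "H = fps_expansion h 0"
    and G1: "fps_nth G 1 = (1 - fps_nth G 0 * cnj (fps_nth G 0)) * fps_nth H 0"
    and G2: "fps_nth G 2 = (1 - fps_nth G 0 * cnj (fps_nth G 0)) *
               (fps_nth H 1 - cnj (fps_nth G 0) * (fps_nth H 0)\<^sup>2)"
    and G3: "fps_nth G 3 = (1 - fps_nth G 0 * cnj (fps_nth G 0)) *
               (fps_nth H 2 - 2 * cnj (fps_nth G 0) * fps_nth H 0 * fps_nth H 1
                  + (cnj (fps_nth G 0))\<^sup>2 * fps_nth H 0 ^ 3)"
    using schur_step_coeffs[OF g(1)] unfolding G_def by blast
  obtain k K where k: "k \<in> schur_class" "K = fps_expansion k 0"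
    and H1: "fps_nth H 1 = (1 - fps_nth H 0 * cnj (fps_nth H 0)) * fps_nth K 0"
    and H2: "fps_nth H 2 = (1 - fps_nth H 0 * cnj (fps_nth H 0)) *
               (fps_nth K 1 - cnj (fps_nth H 0) * (fps_nth K 0)\<^sup>2)"
    using schur_step_coeffs[OF h(1)] unfolding h(2) by blast
  obtain l L where l: "l \<in> schur_class" "L = fps_expansion l 0"
    and K1: "fps_nth K 1 = (1 - fps_nth K 0 * cnj (fps_nth K 0)) * fps_nth L 0"
    using schur_step_coeffs[OF k(1)] unfolding k(2) by blast
  show ?thesis
    by (rule that[of "fps_nth G 0" "fps_nth H 0" "fps_nth K 0" "fps_nth L 0", OF _ _ _ _ refl refl refl])
       (use le[OF g(1)] le[OF h(1)] le[OF k(1)] le[OF l(1)] in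
        \<open>simp_all add: W G_def[symmetric] h(2)[symmetric] k(2)[symmetric] l(2)[symmetric]
           G1[unfolded One_nat_def] G2 G3 H1[unfolded One_nat_def] H2 K1[unfolded One_nat_def]\<close>)
qed

section \<open>The Hankel determinant in terms of the Schwarz function\<close>

text \<open>This is \<open>144 H\<^sub>3(1)\<close> as a polynomial in the coefficients of the Schwarz function; the
  scaling gives the dominant term \<open>c3\<^sup>2\<close> the coefficient \<open>-1\<close>.\<close>
definition schwarz_hankel :: "complex \<Rightarrow> complex \<Rightarrow> complex \<Rightarrow> complex \<Rightarrow> complex" where
  "schwarz_hankel c1 c2 c3 c4 =
     6/5 * c2 * c4 - c3\<^sup>2 - 1/5 * c1 * c2 * c3 + 1/6 * c1 ^ 3 * c3 + 8/15 * c2 ^ 3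
     - 1/4 * c1\<^sup>2 * c2\<^sup>2 + 1/60 * c1 ^ 4 * c2 - 1/144 * c1 ^ 6"

lemma class_C_e_eventually_ode:
  assumes "f \<in> class_C_e"
  obtains w where "schwarz_function w"
    "\<forall>\<^sub>F z in nhds 0. z * deriv (deriv f) z = deriv f z * (exp (w z) - 1)"
proof -
  have A: "f \<in> class_A" using assms by (simp add: class_C_e_def)
  obtain w where w: "schwarz_function w"
    "\<And>z. norm z < 1 \<Longrightarrow> 1 + z * deriv (deriv f) z / deriv f z = exp (w z)"
    using assms unfolding class_C_e_def subordinate_def by auto
  have "deriv f holomorphic_on ball 0 1"
    using A by (auto simp: class_A_def intro: holomorphic_deriv)
  then have "isCont (deriv f) 0"
    by (auto simp: continuous_on_eq_continuous_at dest: holomorphic_on_imp_continuous_on)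
  then have "\<forall>\<^sub>F z in nhds 0. deriv f z \<noteq> 0"
    using A by (intro tendsto_imp_eventually_ne[of _ 1])
      (auto simp: class_A_def isCont_def tendsto_nhds_iff)
  with eventually_in_unit_disc
  have "\<forall>\<^sub>F z in nhds 0. z * deriv (deriv f) z = deriv f z * (exp (w z) - 1)"
    by eventually_elim (simp flip: w(2))
  then show ?thesis using that w(1) by blast
qed

text \<open>The differential equation is required near \<open>0\<close> only, where \<open>f' \<noteq> 0\<close> and multiplying by
  \<open>f'\<close> loses nothing.\<close>
lemma taylor_coeff_convex_exp:
  assumes f: "f \<in> class_A" and w: "w holomorphic_on ball 0 1" "w 0 = 0"
    and ode: "\<forall>\<^sub>F z in nhds 0. z * deriv (deriv f) z = deriv f z * (exp (w z) - 1)"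
  defines "W \<equiv> fps_expansion w 0"
  defines "c1 \<equiv> fps_nth W 1" and "c2 \<equiv> fps_nth W 2"
    and "c3 \<equiv> fps_nth W 3" and "c4 \<equiv> fps_nth W 4"
  shows "taylor_coeff f 1 = 1"
    and "taylor_coeff f 2 = c1 / 2"
    and "taylor_coeff f 3 = (c2 + 3/2 * c1\<^sup>2) / 6"
    and "taylor_coeff f 4 = (c3 + 5/2 * c1 * c2 + 17/12 * c1 ^ 3) / 12"
    and "taylor_coeff f 5 =
      (c4 + 7/3 * c1 * c3 + c2\<^sup>2 + 10/3 * c1\<^sup>2 * c2 + 19/18 * c1 ^ 4) / 20"
proof -
  define F where "F = fps_expansion f 0"
  define E where "E = fps_expansion (\<lambda>z. exp (w z)) 0"
  have fF: "f has_fps_expansion F" and wW: "w has_fps_expansion W"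
    and eE: "(\<lambda>z. exp (w z)) has_fps_expansion E"
    unfolding F_def W_def E_def using f w
    by (auto simp: class_A_def intro!: holomorphic_on_unit_disc_has_fps_expansion holomorphic_intros)
  have W0: "fps_nth W 0 = 0" and E0: "fps_nth E 0 = 1"
    using has_fps_expansion_imp_0_eq_fps_nth_0[OF wW] has_fps_expansion_imp_0_eq_fps_nth_0[OF eE] w(2)
    by auto
  have F1: "fps_nth F (Suc 0) = 1"
    using fps_nth_fps_expansion[OF fF, of 1] f by (simp add: class_A_def)
  (* The coefficients of exp(w) come from the linear equation E' = W' E, which is easier to solve
     for them than the composition of power series is to expand. *)
  have "deriv (\<lambda>z. exp (w z)) has_fps_expansion fps_deriv W * E"
  proof (subst has_fps_expansion_cong[OF _ refl])
    show "\<forall>\<^sub>F z in nhds 0. deriv (\<lambda>z. exp (w z)) z = deriv w z * exp (w z)"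
      using eventually_in_unit_disc
    proof eventually_elim
      case (elim z)
      then have "(w has_field_derivative deriv w z) (at z)"
        using w(1) by (intro holomorphic_derivI[of w "ball 0 1"]) auto
      then have "((\<lambda>z. exp (w z)) has_field_derivative exp (w z) * deriv w z) (at z)"
        by (rule DERIV_fun_exp)
      then show ?case by (simp add: DERIV_imp_deriv mult.commute)
    qed
    show "(\<lambda>z. deriv w z * exp (w z)) has_fps_expansion fps_deriv W * E"
      by (intro fps_expansion_intros wW eE)
  qed
  then have dE: "fps_deriv E = fps_deriv W * E"
    using fps_expansion_unique_complex has_fps_expansion_deriv[OF eE] by blast
  have "(\<lambda>z. z * deriv (deriv f) z) has_fps_expansion fps_X * fps_deriv (fps_deriv F)"
    by (intro fps_expansion_intros fF)
  moreover have "(\<lambda>z. z * deriv (deriv f) z) has_fps_expansion fps_deriv F * (E - 1)"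
    by (subst has_fps_expansion_cong[OF ode refl]) (intro fps_expansion_intros fF eE)
  ultimately have eq: "fps_X * fps_deriv (fps_deriv F) = fps_deriv F * (E - 1)"
    by (rule fps_expansion_unique_complex)
  have nE: "of_nat (Suc n) * fps_nth E (Suc n) = fps_nth (fps_deriv W * E) n" for n
    using arg_cong[OF dE, of "\<lambda>A. fps_nth A n"] by simp
  have nF: "fps_nth (fps_X * fps_deriv (fps_deriv F)) n = fps_nth (fps_deriv F * (E - 1)) n" for n
    by (simp add: eq)
  note expand = fps_mult_nth eval_nat_numeral c1_def c2_def c3_def c4_def
  have E1: "fps_nth E 1 = c1"
    using nE[of 0] E0 by (simp add: c1_def)
  have "2 * fps_nth E 2 = c1 * fps_nth E 1 + 2 * c2"
    using nE[of 1] E0 by (simp add: expand)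
  then have E2: "fps_nth E 2 = c2 + c1\<^sup>2 / 2"
    unfolding E1 by (simp add: field_simps power2_eq_square)
  have "3 * fps_nth E 3 = c1 * fps_nth E 2 + 2 * c2 * fps_nth E 1 + 3 * c3"
    using nE[of 2] E0 by (simp add: expand)
  then have e3: "fps_nth E 3 = (c1 * fps_nth E 2 + 2 * c2 * fps_nth E 1 + 3 * c3) / 3"
    by (simp add: field_simps)
  have E3: "fps_nth E 3 = c3 + c1 * c2 + c1 ^ 3 / 6"
    unfolding e3 E1 E2 by (simp add: field_simps power2_eq_square power3_eq_cube)
  have "4 * fps_nth E 4 = c1 * fps_nth E 3 + 2 * c2 * fps_nth E 2 + 3 * c3 * fps_nth E 1 + 4 * c4"
    using nE[of 3] E0 by (simp add: expand)
  then have e4: "fps_nth E 4 =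
      (c1 * fps_nth E 3 + 2 * c2 * fps_nth E 2 + 3 * c3 * fps_nth E 1 + 4 * c4) / 4"
    by (simp add: field_simps)
  have E4: "fps_nth E 4 = c4 + c1 * c3 + c2\<^sup>2 / 2 + c1\<^sup>2 * c2 / 2 + c1 ^ 4 / 24"
    unfolding e4 E1 E2 E3 by (simp add: field_simps power2_eq_square power3_eq_cube power4_eq_xxxx)
  have "2 * fps_nth F 2 = fps_nth E 1"
    using nF[of 1] F1 E0 by (simp add: expand)
  then have F2: "fps_nth F 2 = c1 / 2"
    unfolding E1 by (simp add: field_simps)
  have "6 * fps_nth F 3 = fps_nth E 2 + 2 * fps_nth F 2 * fps_nth E 1"
    using nF[of 2] F1 E0 by (simp add: expand)
  then have f3: "fps_nth F 3 = (fps_nth E 2 + 2 * fps_nth F 2 * fps_nth E 1) / 6"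
    by (simp add: field_simps)
  have F3: "fps_nth F 3 = (c2 + 3/2 * c1\<^sup>2) / 6"
    unfolding f3 E1 E2 F2 by (simp add: field_simps power2_eq_square)
  have "12 * fps_nth F 4 = fps_nth E 3 + 2 * fps_nth F 2 * fps_nth E 2 + 3 * fps_nth F 3 * fps_nth E 1"
    using nF[of 3] F1 E0 by (simp add: expand)
  then have f4: "fps_nth F 4 =
      (fps_nth E 3 + 2 * fps_nth F 2 * fps_nth E 2 + 3 * fps_nth F 3 * fps_nth E 1) / 12"
    by (simp add: field_simps)
  have F4: "fps_nth F 4 = (c3 + 5/2 * c1 * c2 + 17/12 * c1 ^ 3) / 12"
    unfolding f4 E1 E2 E3 F2 F3 by (simp add: field_simps power2_eq_square power3_eq_cube)
  have "20 * fps_nth F 5 = fps_nth E 4 + 2 * fps_nth F 2 * fps_nth E 3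
      + 3 * fps_nth F 3 * fps_nth E 2 + 4 * fps_nth F 4 * fps_nth E 1"
    using nF[of 4] F1 E0 by (simp add: expand)
  then have f5: "fps_nth F 5 = (fps_nth E 4 + 2 * fps_nth F 2 * fps_nth E 3
      + 3 * fps_nth F 3 * fps_nth E 2 + 4 * fps_nth F 4 * fps_nth E 1) / 20"
    by (simp add: field_simps)
  have F5: "fps_nth F 5 =
      (c4 + 7/3 * c1 * c3 + c2\<^sup>2 + 10/3 * c1\<^sup>2 * c2 + 19/18 * c1 ^ 4) / 20"
    unfolding f5 E1 E2 E3 E4 F2 F3 F4
    by (simp add: field_simps power2_eq_square power3_eq_cube power4_eq_xxxx)
  show "taylor_coeff f 1 = 1"
    and "taylor_coeff f 2 = c1 / 2"
    and "taylor_coeff f 3 = (c2 + 3/2 * c1\<^sup>2) / 6"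
    and "taylor_coeff f 4 = (c3 + 5/2 * c1 * c2 + 17/12 * c1 ^ 3) / 12"
    and "taylor_coeff f 5 =
      (c4 + 7/3 * c1 * c3 + c2\<^sup>2 + 10/3 * c1\<^sup>2 * c2 + 19/18 * c1 ^ 4) / 20"
    using F1 F2 F3 F4 F5 by (simp_all add: taylor_coeff_def F_def)
qed

lemma det_mat_2_2:
  fixes f :: "nat \<times> nat \<Rightarrow> 'a :: comm_ring_1"
  shows "Determinant.det (Matrix.mat 2 2 f) = f (0, 0) * f (1, 1) - f (1, 0) * f (0, 1)"
  by (subst laplace_expansion_column[of _ 2 0])
     (simp_all add: cofactor_def mat_delete_def det_single numeral_2_eq_2)

lemma hankel_det_3_1:
  assumes "a 1 = 1"
  shows "hankel_det a 3 1 =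
    2 * a 2 * a 3 * a 4 - (a 3) ^ 3 - (a 4)\<^sup>2 - (a 2)\<^sup>2 * a 5 + a 3 * a 5"
proof -
  define M where "M = Matrix.mat 3 3 (\<lambda>(i, j). a (1 + i + j))"
  have M: "M \<in> carrier_mat 3 3" by (simp add: M_def)
  have "Determinant.det M = (\<Sum>i<3. M $$ (i, 0) * cofactor M i 0)"
    by (rule laplace_expansion_column[OF M]) simp
  also have "\<dots> = 2 * a 2 * a 3 * a 4 - (a 3) ^ 3 - (a 4)\<^sup>2 - (a 2)\<^sup>2 * a 5 + a 3 * a 5"
    using assms
    by (simp add: M_def cofactor_def mat_delete_def det_mat_2_2[unfolded numeral_2_eq_2]
        eval_nat_numeral algebra_simps)
  finally show ?thesis by (simp add: hankel_det_def M_def)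
qed

lemma hankel_det_convex_exp:
  assumes "f \<in> class_A" "w holomorphic_on ball 0 1" "w 0 = 0"
    and "\<forall>\<^sub>F z in nhds 0. z * deriv (deriv f) z = deriv f z * (exp (w z) - 1)"
  defines "W \<equiv> fps_expansion w 0"
  shows "144 * hankel_det (taylor_coeff f) 3 1 =
    schwarz_hankel (fps_nth W 1) (fps_nth W 2) (fps_nth W 3) (fps_nth W 4)"
  unfolding hankel_det_3_1[of "taylor_coeff f", OF taylor_coeff_convex_exp(1)[OF assms(1-4)]]
    taylor_coeff_convex_exp[OF assms(1-4)] W_def schwarz_hankel_def
  by (simp add: field_simps eval_nat_numeral)

section \<open>The bound\<close>

text \<open>Here \<open>c, u, v\<close> stand for the moduli of the first three Schur parameters. The terms with
  \<open>v\<^sup>2\<close> have total coefficient \<open>S\<^sup>2 R (1 - u) (1 - u / 5) \<ge> 0\<close>, so \<open>v = 1\<close> is the worst case.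
  What remains is compared with \<open>1 = (S + c\<^sup>2)\<^sup>2\<close>. Equality holds at \<open>c = u = 0\<close>, \<open>v = 1\<close>, so
  the estimates have to keep the deficit quadratic there; crude ones still leave
  \<open>S\<^sup>2\<close> times the form \<open>4/15 u\<^sup>2 - 3/5 c u + 71/60 c\<^sup>2\<close>, which is positive definite.\<close>
lemma schur_parameter_inequality:
  fixes c u v :: real
  assumes c: "0 \<le> c" "c \<le> 1" and u: "0 \<le> u" "u \<le> 1" and v: "0 \<le> v" "v \<le> 1"
  defines "S \<equiv> 1 - c\<^sup>2" and "R \<equiv> 1 - u\<^sup>2"
  shows "S\<^sup>2 * R * (R + 6/5 * u\<^sup>2) * v\<^sup>2 + 6/5 * S\<^sup>2 * R * u * (1 - v\<^sup>2)
    + c * S * R * (2/5 * S * u\<^sup>2 + 1/5 * S * u + c\<^sup>2 / 6) * v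
    + S\<^sup>2 * c\<^sup>2 * (1/5 * u ^ 4 + 1/5 * u ^ 3 + 1/4 * u\<^sup>2)
    + S * c ^ 4 * (1/6 * u\<^sup>2 + 1/60 * u) + 8/15 * S ^ 3 * u ^ 3 + c ^ 6 / 144 \<le> 1"
proof -
  have sq: "0 \<le> c\<^sup>2" "c\<^sup>2 \<le> 1" "u\<^sup>2 \<le> u" "v\<^sup>2 \<le> 1" "u\<^sup>2 \<le> 1" "u ^ 3 \<le> u\<^sup>2" "u^3 \<le> 1" "u^4 \<le> 1"
    "c ^ 3 \<le> c\<^sup>2" "c ^ 6 \<le> c ^ 4"
    using c u v power_decreasing[of 1 2 u] power_decreasing[of 2 3 u] power_decreasing[of 2 3 c]
      power_decreasing[of 4 6 c] by (simp_all add: power_le_one)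
  then have S: "0 \<le> S" "S \<le> 1" and R: "0 \<le> R" "R \<le> 1" by (auto simp: S_def R_def)
  have "S\<^sup>2 * R * (1 + u\<^sup>2 / 5)
      - (S\<^sup>2 * R * (R + 6/5 * u\<^sup>2) * v\<^sup>2 + 6/5 * S\<^sup>2 * R * u * (1 - v\<^sup>2))
      = S\<^sup>2 * R * (1 - v\<^sup>2) * ((1 - u) * (1 - u / 5))"
    by (simp add: R_def field_simps power2_eq_square)
  also have "\<dots> \<ge> 0" using S R sq u by (intro mult_nonneg_nonneg) auto
  finally have A: "S\<^sup>2 * R * (R + 6/5 * u\<^sup>2) * v\<^sup>2 + 6/5 * S\<^sup>2 * R * u * (1 - v\<^sup>2)
      \<le> S\<^sup>2 * R * (1 + u\<^sup>2 / 5)" by simp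
  have "c * S * R * (2/5 * S * u\<^sup>2 + 1/5 * S * u + c\<^sup>2 / 6) * v
      \<le> c * S * 1 * (2/5 * S * u + 1/5 * S * u + c\<^sup>2 / 6) * 1"
    using c u v S R sq by (intro mult_mono mult_nonneg_nonneg add_mono add_nonneg_nonneg order_refl) auto
  also have "\<dots> = 3/5 * S\<^sup>2 * c * u + S * c ^ 3 / 6"
    by (simp add: field_simps eval_nat_numeral)
  also have "S * c ^ 3 / 6 \<le> S * c\<^sup>2 / 6"
    using S sq by (simp add: mult_left_mono)
  finally have B: "c * S * R * (2/5 * S * u\<^sup>2 + 1/5 * S * u + c\<^sup>2 / 6) * v
      \<le> 3/5 * S\<^sup>2 * c * u + S * c\<^sup>2 / 6" by simp
  have S2: "S\<^sup>2 \<le> S" using S by (simp add: power2_eq_square mult_left_le)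
  have C: "S\<^sup>2 * c\<^sup>2 * (1/5 * u ^ 4 + 1/5 * u ^ 3 + 1/4 * u\<^sup>2) \<le> S * c\<^sup>2 * (13/20)"
    using S sq S2 u by (intro mult_mono) auto
  have D: "S * c ^ 4 * (1/6 * u\<^sup>2 + 1/60 * u) \<le> 1 * c ^ 4 * (11/60)"
    using S sq u by (intro mult_mono) auto
  have "S ^ 3 * u ^ 3 \<le> S\<^sup>2 * u\<^sup>2"
    using S sq u by (intro mult_mono power_decreasing) auto
  then have E: "8/15 * S ^ 3 * u ^ 3 \<le> 8/15 * (S\<^sup>2 * u\<^sup>2)" by simp
  (* 71/60 = 2 - 1/6 - 13/20 is what the terms S c^2 in one, B and C leave over. *)
  have "S\<^sup>2 * (4/15 * u\<^sup>2 - 3/5 * c * u + 71/60 * c\<^sup>2) =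
      S\<^sup>2 * (4/15 * (u - 9/8 * c)\<^sup>2 + 203/240 * c\<^sup>2)"
    by (simp add: field_simps power2_eq_square)
  also have "\<dots> \<ge> 0" by simp
  finally have "0 \<le> S\<^sup>2 * (4/15 * u\<^sup>2 - 3/5 * c * u) + 71/60 * S\<^sup>2 * c\<^sup>2"
    by (simp add: algebra_simps)
  also have "\<dots> \<le> S\<^sup>2 * (4/15 * u\<^sup>2 - 3/5 * c * u) + 71/60 * S * c\<^sup>2"
    using S2 sq by (simp add: mult_right_mono)
  finally have Q: "0 \<le> S\<^sup>2 * (4/15 * u\<^sup>2 - 3/5 * c * u) + 71/60 * S * c\<^sup>2" .
  have one: "1 = S\<^sup>2 + 2 * S * c\<^sup>2 + c ^ 4"
    by (simp add: S_def field_simps eval_nat_numeral)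
  have top: "S\<^sup>2 * R * (1 + u\<^sup>2 / 5) = S\<^sup>2 - 4/5 * S\<^sup>2 * u\<^sup>2 - S\<^sup>2 * u ^ 4 / 5"
    by (simp add: R_def field_simps eval_nat_numeral)
  have "S\<^sup>2 * R * (1 + u\<^sup>2 / 5) + (3/5 * S\<^sup>2 * c * u + S * c\<^sup>2 / 6) + S * c\<^sup>2 * (13/20)
      + 1 * c ^ 4 * (11/60) + 8/15 * (S\<^sup>2 * u\<^sup>2) + c ^ 4 / 144
      = (S\<^sup>2 + 2 * S * c\<^sup>2 + c ^ 4)
        - (S\<^sup>2 * (4/15 * u\<^sup>2 - 3/5 * c * u) + 71/60 * S * c\<^sup>2) - S\<^sup>2 * u ^ 4 / 5 - 583/720 * c ^ 4"
    unfolding top by (simp add: field_simps)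
  moreover have "0 \<le> S\<^sup>2 * u ^ 4 / 5" "0 \<le> 583/720 * c ^ 4" by auto
  ultimately show ?thesis
    using A B C D E Q sq(10) one by linarith
qed

lemma norm_1_minus_mult_cnj:
  assumes "norm (z :: complex) \<le> 1"
  shows "norm (1 - z * cnj z) = 1 - (norm z)\<^sup>2"
proof -
  have "1 - z * cnj z = of_real (1 - (norm z)\<^sup>2)"
    by (simp only: of_real_diff of_real_1 complex_norm_square)
  moreover have "(norm z)\<^sup>2 \<le> 1" using assms by (simp add: power_le_one)
  ultimately show ?thesis by (simp only: norm_of_real)
qed

text \<open>The summands \<open>P1, P2, P3\<close> collect what depends on \<open>y\<close> and \<open>\<zeta>\<close>; the others are
  grouped by powers of \<open>s\<close>, and each of these groups is estimated separately.\<close>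
lemma norm_schwarz_hankel_le:
  assumes "schwarz_function w"
  defines "W \<equiv> fps_expansion w 0"
  shows "norm (schwarz_hankel (fps_nth W 1) (fps_nth W 2) (fps_nth W 3) (fps_nth W 4)) \<le> 1"
proof -
  obtain c x y \<zeta> s r t where le: "norm c \<le> 1" "norm x \<le> 1" "norm y \<le> 1" "norm \<zeta> \<le> 1"
    and srt: "s = 1 - c * cnj c" "r = 1 - x * cnj x" "t = 1 - y * cnj y"
    and W: "fps_nth W 1 = c" "fps_nth W 2 = s * x"
    "fps_nth W 3 = s * (r * y - cnj c * x\<^sup>2)"
    "fps_nth W 4 = s * (r * (t * \<zeta> - cnj x * y\<^sup>2) - 2 * cnj c * x * (r * y) + (cnj c)\<^sup>2 * x ^ 3)"
    unfolding W_def using schwarz_function_coeffs[OF assms(1)] by metis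
  define S R T where "S = 1 - (norm c)\<^sup>2" and "R = 1 - (norm x)\<^sup>2" and "T = 1 - (norm y)\<^sup>2"
  have n: "norm s = S" "norm r = R" "norm t = T"
    unfolding srt S_def R_def T_def using le by (auto intro: norm_1_minus_mult_cnj)
  have nn: "0 \<le> S" "0 \<le> R" "0 \<le> T"
    using n by (metis norm_ge_zero)+
  (* The y^2 parts of c2 c4 and of c3^2 add up without cancellation: the factor x of c2 meets
     cnj x in c4. *)
  define P1 P2 P3 P4 P5 P6 P7 where
    "P1 = - (s\<^sup>2 * r * (r + 6/5 * (x * cnj x)) * y\<^sup>2)"
    and "P2 = 6/5 * s\<^sup>2 * r * x * t * \<zeta>"
    and "P3 = s * r * (c ^ 3 / 6 - 2/5 * s * cnj c * x\<^sup>2 - 1/5 * s * c * x) * y"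
    and "P4 = s\<^sup>2 * (1/5 * (cnj c)\<^sup>2 * x ^ 4 + 1/5 * c * cnj c * x ^ 3 - 1/4 * c\<^sup>2 * x\<^sup>2)"
    and "P5 = s * (1/60 * c ^ 4 * x - 1/6 * c ^ 3 * cnj c * x\<^sup>2)"
    and "P6 = 8/15 * s ^ 3 * x ^ 3"
    and "P7 = - (c ^ 6 / 144)"
  note defs = P1_def P2_def P3_def P4_def P5_def P6_def P7_def
  have eq: "schwarz_hankel (fps_nth W 1) (fps_nth W 2) (fps_nth W 3) (fps_nth W 4)
      = P1 + P2 + P3 + P4 + P5 + P6 + P7"
    unfolding W schwarz_hankel_def defs by (simp add: field_simps eval_nat_numeral)
  have tri3: "norm (a + b + d :: complex) \<le> norm a + norm b + norm d" for a b d
    by (meson norm_triangle_ineq norm_triangle_le add_mono order_refl order_trans)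
  have r6: "norm (r + 6/5 * (x * cnj x)) \<le> R + 6/5 * (norm x)\<^sup>2"
    using norm_triangle_ineq[of r "6/5 * (x * cnj x)"]
    by (simp add: norm_mult norm_divide n power2_eq_square)
  have "norm P1 = S\<^sup>2 * R * norm (r + 6/5 * (x * cnj x)) * (norm y)\<^sup>2"
    unfolding defs by (simp add: norm_mult norm_power n)
  also have "\<dots> \<le> S\<^sup>2 * R * (R + 6/5 * (norm x)\<^sup>2) * (norm y)\<^sup>2"
    using r6 nn by (intro mult_mono) auto
  finally have p1: "norm P1 \<le> S\<^sup>2 * R * (R + 6/5 * (norm x)\<^sup>2) * (norm y)\<^sup>2" .
  have "norm P2 = 6/5 * S\<^sup>2 * R * norm x * T * norm \<zeta>"
    unfolding defs by (simp add: norm_mult norm_power norm_divide n)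
  also have "\<dots> \<le> 6/5 * S\<^sup>2 * R * norm x * T * 1"
    using nn le by (intro mult_left_mono mult_nonneg_nonneg) auto
  finally have p2: "norm P2 \<le> 6/5 * S\<^sup>2 * R * norm x * (1 - (norm y)\<^sup>2)" by (simp add: T_def)
  have b3: "norm (c ^ 3 / 6 - 2/5 * s * cnj c * x\<^sup>2 - 1/5 * s * c * x)
      \<le> (norm c) ^ 3 / 6 + 2/5 * S * norm c * (norm x)\<^sup>2 + 1/5 * S * norm c * norm x"
    using tri3[of "c ^ 3 / 6" "- (2/5 * s * cnj c * x\<^sup>2)" "- (1/5 * s * c * x)"]
    by (simp add: norm_mult norm_power norm_divide n)
  have "norm P3 = S * R * norm (c ^ 3 / 6 - 2/5 * s * cnj c * x\<^sup>2 - 1/5 * s * c * x) * norm y"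
    unfolding defs by (simp add: norm_mult n)
  also have "\<dots> \<le> S * R * ((norm c) ^ 3 / 6 + 2/5 * S * norm c * (norm x)\<^sup>2 + 1/5 * S * norm c * norm x) * norm y"
    using b3 nn by (intro mult_mono) auto
  also have "\<dots> = norm c * S * R * (2/5 * S * (norm x)\<^sup>2 + 1/5 * S * norm x + (norm c)\<^sup>2 / 6) * norm y"
    by (simp add: field_simps eval_nat_numeral)
  finally have p3: "norm P3 \<le> \<dots>" .
  have "norm P4 \<le> S\<^sup>2 * (1/5 * (norm c)\<^sup>2 * (norm x) ^ 4 + 1/5 * norm c * norm c * (norm x) ^ 3
        + 1/4 * (norm c)\<^sup>2 * (norm x)\<^sup>2)"
    unfolding defs using mult_left_mono[OF tri3[of "1/5 * (cnj c)\<^sup>2 * x ^ 4" "1/5 * c * cnj c * x ^ 3"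
       "- (1/4 * c\<^sup>2 * x\<^sup>2)"], of "S\<^sup>2"]
    by (simp add: norm_mult norm_power norm_divide n)
  also have "\<dots> = S\<^sup>2 * (norm c)\<^sup>2 * (1/5 * (norm x) ^ 4 + 1/5 * (norm x) ^ 3 + 1/4 * (norm x)\<^sup>2)"
    by (simp add: field_simps eval_nat_numeral)
  finally have p4: "norm P4 \<le> \<dots>" .
  have "norm P5 \<le> S * (1/60 * (norm c) ^ 4 * norm x + 1/6 * (norm c) ^ 3 * norm c * (norm x)\<^sup>2)"
    unfolding defs using mult_left_mono[OF norm_triangle_ineq4[of "1/60 * c ^ 4 * x" "1/6 * c ^ 3 * cnj c * x\<^sup>2"] nn(1)]
    by (simp add: norm_mult norm_power norm_divide n)
  also have "\<dots> = S * (norm c) ^ 4 * (1/6 * (norm x)\<^sup>2 + 1/60 * norm x)"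
    by (simp add: field_simps eval_nat_numeral)
  finally have p5: "norm P5 \<le> \<dots>" .
  have p6: "norm P6 = 8/15 * S ^ 3 * (norm x) ^ 3" and p7: "norm P7 = (norm c) ^ 6 / 144"
    unfolding defs by (simp_all add: norm_mult norm_power norm_divide n)
  have "norm (P1 + P2 + P3 + P4 + P5 + P6 + P7)
      \<le> norm P1 + norm P2 + norm P3 + norm P4 + norm P5 + norm P6 + norm P7"
    by (intro norm_triangle_le add_mono order_refl)
  also have "\<dots> \<le> 1"
    using schur_parameter_inequality[of "norm c" "norm x" "norm y"] le p1 p2 p3 p4 p5 p6 p7
    unfolding S_def R_def by simp
  finally show ?thesis unfolding eq .
qed

section \<open>The extremal function\<close>

text \<open>The equation is linear of first order in \<open>f'\<close> and \<open>(exp w - 1)/z\<close> is holomorphic, so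
  \<open>f'\<close> is the exponential of a primitive of the latter. In particular \<open>f'\<close> has no zeros.\<close>
lemma convex_exp_function_exists:
  assumes w: "schwarz_function w"
  obtains f where "f \<in> class_C_e"
    "\<And>z. norm z < 1 \<Longrightarrow> z * deriv (deriv f) z = deriv f z * (exp (w z) - 1)"
proof -
  have wh: "w holomorphic_on ball 0 1" and w0: "w 0 = 0"
    using w by (auto simp: schwarz_function_def)
  have "(\<lambda>z. exp (w z) - 1) holomorphic_on ball 0 1"
    by (intro holomorphic_intros wh)
  then obtain h where h: "h holomorphic_on ball 0 1"
    "\<And>z. norm z < 1 \<Longrightarrow> exp (w z) - 1 = z * h z"
    by (rule Schwarz3) (use w0 in auto)
  obtain p where p: "\<And>z. z \<in> ball 0 1 \<Longrightarrow> (p has_field_derivative h z) (at z within ball 0 1)"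
    using holomorphic_convex_primitive'[OF _ _ h(1)] by auto
  have p': "(p has_field_derivative h z) (at z)" if "norm z < 1" for z
    using p[of z] that by (simp add: at_within_open[of z "ball 0 1"])
  define q where "q = (\<lambda>z. exp (p z - p 0))"
  have q': "(q has_field_derivative h z * q z) (at z)" if "norm z < 1" for z
    unfolding q_def using p'[OF that] by (auto intro!: derivative_eq_intros)
  then have q_hol: "q holomorphic_on ball 0 1"
    by (intro holomorphic_onI) (auto simp: field_differentiable_def intro: has_field_derivative_at_within)
  obtain k where k: "\<And>z. z \<in> ball 0 1 \<Longrightarrow> (k has_field_derivative q z) (at z within ball 0 1)"
    using holomorphic_convex_primitive'[OF _ _ q_hol] by auto
  define f where "f = (\<lambda>z. k z - k 0)"
  have f': "(f has_field_derivative q z) (at z)" if "norm z < 1" for z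
    using k[of z] that unfolding f_def
    by (auto simp: at_within_open[of z "ball 0 1"] intro!: derivative_eq_intros)
  have df: "deriv f z = q z" if "norm z < 1" for z
    using f'[OF that] by (rule DERIV_imp_deriv)
  have ddf: "deriv (deriv f) z = h z * q z" if z: "norm z < 1" for z
  proof -
    have "\<forall>\<^sub>F \<xi> in nhds z. deriv f \<xi> = q \<xi>"
      using eventually_nhds_in_open[of "ball 0 1" z] z df by (auto elim!: eventually_mono)
    then have "deriv (deriv f) z = deriv q z" by (intro deriv_cong_ev) auto
    then show ?thesis using DERIV_imp_deriv[OF q'[OF z]] by simp
  qed
  have f_hol: "f holomorphic_on ball 0 1"
    using f' by (intro holomorphic_onI)
      (auto simp: field_differentiable_def intro: has_field_derivative_at_within)
  have A: "f \<in> class_A"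
    unfolding class_A_def using df[of 0] f_hol by (simp add: f_def q_def)
  have quot: "1 + z * deriv (deriv f) z / deriv f z = exp (w z)" if z: "norm z < 1" for z
    using h(2)[OF z] by (simp add: df[OF z] ddf[OF z] q_def algebra_simps)
  have "(\<lambda>z. exp (w z)) holomorphic_on ball 0 1" by (intro holomorphic_intros wh)
  then have "(\<lambda>z. 1 + z * deriv (deriv f) z / deriv f z) holomorphic_on ball 0 1"
    by (rule holomorphic_transform) (use quot in auto)
  then have "f \<in> class_C_e"
    using A w quot unfolding class_C_e_def subordinate_def
    by (auto intro!: holomorphic_intros exI[of _ w])
  then show ?thesis
    using that h(2) by (metis (no_types, lifting) df ddf mult.assoc mult.commute)
qed

theorem theorem3p1:
  shows "(\<forall>f\<in>class_C_e.
      let a = taylor_coeff f; H = hankel_det a 3 1 in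
        H = 2 * a 2 * a 3 * a 4 - (a 3) ^ 3 - (a 4)\<^sup>2 - (a 2)\<^sup>2 * a 5 + a 3 * a 5 \<and>
        norm H \<le> 1 / 144)
    \<and> (\<exists>f\<in>class_C_e. norm (hankel_det (taylor_coeff f) 3 1) = 1 / 144)"
proof (intro conjI ballI)
  fix f assume f: "f \<in> class_C_e"
  then have A: "f \<in> class_A" by (simp add: class_C_e_def)
  obtain w where w: "schwarz_function w"
    and ode: "\<forall>\<^sub>F z in nhds 0. z * deriv (deriv f) z = deriv f z * (exp (w z) - 1)"
    using class_C_e_eventually_ode[OF f] by blast
  have wh: "w holomorphic_on ball 0 1" "w 0 = 0"
    using w by (auto simp: schwarz_function_def)
  have "norm (144 * hankel_det (taylor_coeff f) 3 1) \<le> 1"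
    unfolding hankel_det_convex_exp[OF A wh ode] by (rule norm_schwarz_hankel_le[OF w])
  then have "norm (hankel_det (taylor_coeff f) 3 1) \<le> 1 / 144"
    by (simp add: norm_mult)
  then show "let a = taylor_coeff f; H = hankel_det a 3 1 in
        H = 2 * a 2 * a 3 * a 4 - (a 3) ^ 3 - (a 4)\<^sup>2 - (a 2)\<^sup>2 * a 5 + a 3 * a 5 \<and>
        norm H \<le> 1 / 144"
    using hankel_det_3_1[of "taylor_coeff f", OF taylor_coeff_convex_exp(1)[OF A wh ode]]
    by (simp add: Let_def)
next
  define w :: "complex \<Rightarrow> complex" where "w = (\<lambda>z. z ^ 3)"
  have w: "schwarz_function w"
  proof -
    have "norm z ^ 3 \<le> norm z" if "norm z < 1" for z :: complex
      using that power_decreasing[of 1 3 "norm z"] by simp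
    then show ?thesis
      by (auto simp: schwarz_function_def w_def norm_power intro!: holomorphic_intros)
  qed
  then have wh: "w holomorphic_on ball 0 1" "w 0 = 0"
    by (auto simp: schwarz_function_def)
  obtain f where f: "f \<in> class_C_e"
    "\<And>z. norm z < 1 \<Longrightarrow> z * deriv (deriv f) z = deriv f z * (exp (w z) - 1)"
    using convex_exp_function_exists[OF w] by blast
  have A: "f \<in> class_A" using f(1) by (simp add: class_C_e_def)
  have ode: "\<forall>\<^sub>F z in nhds 0. z * deriv (deriv f) z = deriv f z * (exp (w z) - 1)"
    using eventually_in_unit_disc by eventually_elim (rule f(2))
  have W: "fps_expansion w 0 = fps_X ^ 3"
    unfolding w_def by (rule fps_expansion_eqI) (rule has_fps_expansion_fps_X_power)
  have "144 * hankel_det (taylor_coeff f) 3 1 = -1"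
    unfolding hankel_det_convex_exp[OF A wh ode] W by (simp add: schwarz_hankel_def)
  then have "norm (144 * hankel_det (taylor_coeff f) 3 1) = 1" by simp
  then have "norm (hankel_det (taylor_coeff f) 3 1) = 1 / 144"
    by (simp add: norm_mult)
  with f(1) show "\<exists>f\<in>class_C_e. norm (hankel_det (taylor_coeff f) 3 1) = 1 / 144"
    by blast
qed

end
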